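(* Let $\chi:\mathbb{R}^{2d}\to\mathbb{R}^{2d}$ be a tame canonical transformation. Then $\chi$ satisfies the vertical nonrefocusing condition if and only if $\chi^{-1}$ satisfies the vertical nonrefocusing condition.
   Context: A tame canonical transformation is a smooth map $\chi:\mathbb{R}^{2d}\to\mathbb{R}^{2d}$ such that (i) for every multi-index $\alpha$ with $|\alpha|\ge1$ there is a constant $C_\alpha$ with $|\partial^\alpha\chi(z)|\le C_\alpha$ for all $z\in\mathbb{R}^{2d}$; (ii) $\chi$ is canonical (symplectic): if $(x,\xi)=\chi(y,\eta)$ then $dy\wedge d\eta=dx\wedge d\xi$. (Such a map is a globally bi-Lipschitz diffeomorphism of $\mathbb{R}^{2d}$, and its inverse is again a tame canonical transformation.) Vertical nonrefocusing condition for a map $\chi$: there exist an open conic neighborhood $\Gamma\subset\mathbb{R}^{2d}\setminus\{0\}$ of $\{0\}\times(\mathbb{R}^d\setminus\{0\})$ and $R>0$ such that, for $\eta\in\mathbb{R}^d$, $|\eta|>R$ implies $\chi(0,\eta)\notin\Gamma$. (Conic means invariant under multiplication by positive scalars.) *)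

theory Defs
  imports "HOL-Analysis.Analysis"
begin

text \<open>Phase space \<open>\<real>\<^sup>2\<^sup>d\<close>, written as pairs \<open>(x, \<xi>)\<close>, with \<open>d = CARD('d)\<close>. The norm of the
  product type is the Euclidean norm, and its \<open>Basis\<close> is the standard basis of \<open>\<real>\<^sup>2\<^sup>d\<close>.\<close>

type_synonym 'd phase = "(real ^ 'd) \<times> (real ^ 'd)"

definition partial_deriv ::
    "'a::euclidean_space \<Rightarrow> ('a \<Rightarrow> 'b::real_normed_vector) \<Rightarrow> 'a \<Rightarrow> 'b" where
  "partial_deriv b f z = vector_derivative (\<lambda>t. f (z + t *\<^sub>R b)) (at 0)"

text \<open>The list \<open>bs\<close> of coordinate directions plays the role of the multi-index \<open>\<alpha>\<close>: \<open>\<alpha>\<close> counts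
  the occurrences of each coordinate, and \<open>\<bar>\<alpha>\<bar> = length bs\<close>. Mixed partials of a smooth map
  commute, so the lists representing the same \<open>\<alpha>\<close> all give \<open>\<partial>\<^sup>\<alpha> f\<close>.\<close>

primrec iterated_partial ::
    "'a::euclidean_space list \<Rightarrow> ('a \<Rightarrow> 'b::real_normed_vector) \<Rightarrow> 'a \<Rightarrow> 'b" where
  "iterated_partial [] f = f"
| "iterated_partial (b # bs) f = partial_deriv b (iterated_partial bs f)"

text \<open>If all iterated partial derivatives are (Frechet) differentiable, then they all exist and
  are continuous, which is \<open>C\<^sup>\<infinity>\<close>; the converse is the usual \<open>C\<^sup>1\<close> criterion.\<close>

definition smooth_map :: "('a::euclidean_space \<Rightarrow> 'b::real_normed_vector) \<Rightarrow> bool" where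
  "smooth_map f \<longleftrightarrow> (\<forall>bs. set bs \<subseteq> Basis \<longrightarrow> (\<forall>z. iterated_partial bs f differentiable at z))"

text \<open>The two-form \<open>dx \<and> d\<xi> = \<Sum>\<^sub>j dx\<^sub>j \<and> d\<xi>\<^sub>j\<close> evaluated on a pair of tangent vectors.\<close>

definition symplectic_form :: "'d::finite phase \<Rightarrow> 'd phase \<Rightarrow> real" where
  "symplectic_form u v = (\<Sum>j\<in>UNIV. fst u $ j * snd v $ j - snd u $ j * fst v $ j)"

text \<open>\<open>dy \<and> d\<eta> = dx \<and> d\<xi>\<close> for \<open>(x, \<xi>) = \<kappa> (y, \<eta>)\<close>, that is, \<open>\<kappa>\<close> pulls the form back to itself.\<close>

definition canonical :: "('d::finite phase \<Rightarrow> 'd phase) \<Rightarrow> bool" where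
  "canonical \<kappa> \<longleftrightarrow> (\<forall>z u v.
     symplectic_form (frechet_derivative \<kappa> (at z) u) (frechet_derivative \<kappa> (at z) v)
       = symplectic_form u v)"

text \<open>Bijectivity is not required: it follows from the conditions below (the Jacobian and its inverse
  are bounded), so \<open>inv \<kappa>\<close> is the genuine inverse of a tame canonical transformation \<open>\<kappa>\<close>.\<close>

definition tame_canonical_transformation :: "('d::finite phase \<Rightarrow> 'd phase) \<Rightarrow> bool" where
  "tame_canonical_transformation \<kappa> \<longleftrightarrow>
     smooth_map \<kappa> \<and>
     (\<forall>bs. set bs \<subseteq> Basis \<and> length bs \<ge> 1 \<longrightarrow>
        (\<exists>C. \<forall>z. norm (iterated_partial bs \<kappa> z) \<le> C)) \<and>
     canonical \<kappa>"

definition conic_set :: "'a::real_vector set \<Rightarrow> bool" where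
  "conic_set \<Gamma> \<longleftrightarrow> (\<forall>z\<in>\<Gamma>. \<forall>t>0. t *\<^sub>R z \<in> \<Gamma>)"

definition vertical_nonrefocusing :: "('d::finite phase \<Rightarrow> 'd phase) \<Rightarrow> bool" where
  "vertical_nonrefocusing \<kappa> \<longleftrightarrow>
     (\<exists>\<Gamma> R. open \<Gamma> \<and> conic_set \<Gamma> \<and> \<Gamma> \<subseteq> UNIV - {0} \<and> {0} \<times> (UNIV - {0}) \<subseteq> \<Gamma> \<and>
        R > 0 \<and> (\<forall>\<eta>. norm \<eta> > R \<longrightarrow> \<kappa> (0, \<eta>) \<notin> \<Gamma>))"

end

theory Submission imports Defs
begin

text \<open>Write \<open>\<kappa> (0, \<eta>) = (x, \<xi>)\<close>. The unit sphere of the vertical fibre is compact, so a conic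
  neighborhood of the vertical directions contains a full cone \<open>\<bar>x\<bar> < c \<bar>\<xi>\<bar>\<close>; nonrefocusing therefore
  says that \<open>c \<bar>\<xi>\<bar> \<le> \<bar>x\<bar>\<close> for large \<open>\<eta>\<close> (\<open>vertical_nonrefocusing_iff\<close>). Suppose the inverse
  violates this: \<open>\<kappa> (y, \<eta>) = (0, \<zeta>)\<close> with \<open>\<zeta>\<close> large and \<open>\<bar>y\<bar> \<le> e \<bar>\<eta>\<bar>\<close> for a tiny \<open>e\<close>. Moving
  \<open>(y, \<eta>)\<close> to \<open>(0, \<eta>)\<close> changes the image by at most \<open>L e \<bar>\<eta>\<bar>\<close>, so \<open>\<kappa> (0, \<eta>)\<close> has a base point of
  size at most \<open>L e \<bar>\<eta>\<bar>\<close> although its total size is comparable to \<open>\<bar>\<eta>\<bar>\<close>; this contradicts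
  nonrefocusing of \<open>\<kappa>\<close> (\<open>vertical_nonrefocusing_inverse\<close>). The argument uses only that \<open>\<kappa>\<close> and its
  inverse are Lipschitz, so it is symmetric in the two maps.

  What has to be established is that \<open>\<kappa>\<close> is a bijection with Lipschitz inverse
  (\<open>tame_canonical_transformation_bi_Lipschitz\<close>), which is a global inverse function theorem in the
  manner of Hadamard. Bounded first derivatives make \<open>\<kappa>\<close> Lipschitz; being symplectic then bounds its
  Jacobian from below as well. Bounded second derivatives make the Jacobian Lipschitz, so the inverse
  function theorem holds on balls of one fixed radius: \<open>\<kappa>\<close> expands distances by a fixed factor on all
  balls of that radius. Such a map is a covering of the whole space by itself, hence injective because
  the space is simply connected.\<close>

section \<open>Bounds on partial derivatives\<close>

lemma frechet_derivative_eq_sum_partials: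
  fixes f :: "'a::euclidean_space \<Rightarrow> 'b::real_normed_vector"
  assumes "f differentiable at z"
  shows "frechet_derivative f (at z) u = (\<Sum>b\<in>Basis. (u \<bullet> b) *\<^sub>R partial_deriv b f z)"
proof -
  let ?D = "frechet_derivative f (at z)"
  have D: "(f has_derivative ?D) (at z)"
    using assms by (simp add: frechet_derivative_works)
  interpret D: linear ?D
    by (rule linear_frechet_derivative[OF assms])
  have part: "?D b = partial_deriv b f z" for b
  proof -
    have "((\<lambda>t. z + t *\<^sub>R b) has_derivative (\<lambda>t. t *\<^sub>R b)) (at 0)"
      by (auto intro!: derivative_eq_intros)
    then have "((\<lambda>t. f (z + t *\<^sub>R b)) has_derivative (\<lambda>t. ?D (t *\<^sub>R b))) (at 0)"
      by (rule has_derivative_compose[where g = f]) (simp add: D)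
    then have "((\<lambda>t. f (z + t *\<^sub>R b)) has_vector_derivative ?D b) (at 0)"
      by (simp add: has_vector_derivative_def D.scaleR)
    then show ?thesis
      unfolding partial_deriv_def by (rule vector_derivative_at[symmetric])
  qed
  have "?D u = ?D (\<Sum>b\<in>Basis. (u \<bullet> b) *\<^sub>R b)"
    by (simp add: euclidean_representation)
  also have "\<dots> = (\<Sum>b\<in>Basis. (u \<bullet> b) *\<^sub>R ?D b)"
    by (simp add: D.sum D.scaleR)
  finally show ?thesis
    by (simp add: part)
qed

lemma norm_frechet_derivative_le_of_bounded_partials:
  fixes f :: "'a::euclidean_space \<Rightarrow> 'b::real_normed_vector" and C :: real
  assumes "f differentiable at z"
    and "\<And>b. b \<in> Basis \<Longrightarrow> norm (partial_deriv b f z) \<le> C"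
  shows "norm (frechet_derivative f (at z) u) \<le> DIM('a) * C * norm u"
proof -
  have "norm (frechet_derivative f (at z) u) \<le> (\<Sum>b\<in>Basis. norm ((u \<bullet> b) *\<^sub>R partial_deriv b f z))"
    unfolding frechet_derivative_eq_sum_partials[OF assms(1)] by (rule norm_sum)
  also have "\<dots> \<le> (\<Sum>b\<in>(Basis::'a set). norm u * C)"
  proof (rule sum_mono)
    fix b :: 'a assume "b \<in> Basis"
    then show "norm ((u \<bullet> b) *\<^sub>R partial_deriv b f z) \<le> norm u * C"
      using assms(2) Basis_le_norm by (auto intro!: mult_mono)
  qed
  finally show ?thesis
    by (simp add: mult_ac)
qed

lemma bounded_partials_imp_Lipschitz:
  fixes f :: "'a::euclidean_space \<Rightarrow> 'b::real_normed_vector" and C :: real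
  assumes "\<And>z. f differentiable at z"
    and "\<And>b z. b \<in> Basis \<Longrightarrow> norm (partial_deriv b f z) \<le> C"
  shows "dist (f x) (f y) \<le> DIM('a) * C * dist x y"
proof -
  have "norm (f x - f y) \<le> DIM('a) * C * norm (x - y)"
  proof (rule differentiable_bound[OF convex_UNIV])
    show "(f has_derivative frechet_derivative f (at z)) (at z within UNIV)" for z
      using assms(1) by (simp add: frechet_derivative_works)
    show "onorm (frechet_derivative f (at z)) \<le> DIM('a) * C" for z
      by (rule onorm_le) (rule norm_frechet_derivative_le_of_bounded_partials[OF assms])
  qed auto
  then show ?thesis
    by (simp add: dist_norm)
qed

lemma bounded_second_partials_imp_Lipschitz_derivative:
  fixes f :: "'a::euclidean_space \<Rightarrow> 'b::real_normed_vector" and C :: real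
  assumes f: "\<And>z. f differentiable at z"
    and f': "\<And>b z. b \<in> Basis \<Longrightarrow> partial_deriv b f differentiable at z"
    and f'': "\<And>b c z. b \<in> Basis \<Longrightarrow> c \<in> Basis \<Longrightarrow> norm (partial_deriv c (partial_deriv b f) z) \<le> C"
  shows "norm (frechet_derivative f (at z) u - frechet_derivative f (at w) u)
    \<le> DIM('a) * (DIM('a) * C) * dist z w * norm u"
proof -
  have "frechet_derivative f (at z) u - frechet_derivative f (at w) u
      = (\<Sum>b\<in>Basis. (u \<bullet> b) *\<^sub>R (partial_deriv b f z - partial_deriv b f w))"
    unfolding frechet_derivative_eq_sum_partials[OF f] by (simp add: scaleR_diff_right sum_subtractf)
  also have "norm \<dots> \<le> (\<Sum>b\<in>(Basis::'a set). norm u * (DIM('a) * C * dist z w))"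
  proof (rule order_trans[OF norm_sum sum_mono])
    fix b :: 'a assume b: "b \<in> Basis"
    have "dist (partial_deriv b f z) (partial_deriv b f w) \<le> DIM('a) * C * dist z w"
      by (rule bounded_partials_imp_Lipschitz) (use f' f'' b in auto)
    then show "norm ((u \<bullet> b) *\<^sub>R (partial_deriv b f z - partial_deriv b f w))
        \<le> norm u * (DIM('a) * C * dist z w)"
      using Basis_le_norm[OF b, of u] by (auto simp: dist_norm intro!: mult_mono)
  qed
  finally show ?thesis
    by (simp add: mult_ac)
qed

section \<open>Lower bound for symplectic linear maps\<close>

lemma symplectic_form_eq_inner: "symplectic_form u v = u \<bullet> (snd v, - fst v)"
  by (simp add: symplectic_form_def inner_prod_def inner_vec_def sum_subtractf sum_negf)

lemma abs_symplectic_form_le: "\<bar>symplectic_form u v\<bar> \<le> norm u * norm v"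
proof -
  have "norm (snd v, - fst v) = norm v"
    by (simp add: norm_prod_def add.commute)
  then show ?thesis
    using Cauchy_Schwarz_ineq2[of u "(snd v, - fst v)"] by (simp add: symplectic_form_eq_inner)
qed

text \<open>A symplectic map is inverted by its adjoint up to rotation by the standard complex structure, so
  an upper bound for the map is also one for its inverse. Concretely, \<open>u\<close> is paired with its rotated
  copy \<open>(- snd u, fst u)\<close>: the form takes the value \<open>\<bar>u\<bar>\<^sup>2\<close> there, and it is preserved.\<close>

lemma symplectic_preserving_imp_expanding:
  fixes A :: "'d::finite phase \<Rightarrow> 'd phase"
  assumes pres: "\<And>u v. symplectic_form (A u) (A v) = symplectic_form u v"
    and bound: "\<And>u. norm (A u) \<le> L * norm u"
  shows "norm u \<le> L * norm (A u)"
proof (cases "u = 0")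
  case True
  then show ?thesis
    using bound[of 0] by simp
next
  case False
  let ?v = "(- snd u, fst u)"
  have v: "norm ?v = norm u"
    by (simp add: norm_prod_def add.commute)
  have "norm u * norm u = u \<bullet> u"
    by (simp add: dot_square_norm power2_eq_square)
  also have "\<dots> = symplectic_form u ?v"
    by (simp add: symplectic_form_eq_inner)
  also have "\<dots> = symplectic_form (A u) (A ?v)"
    by (simp add: pres)
  also have "\<dots> \<le> norm (A u) * norm (A ?v)"
    using abs_symplectic_form_le by (rule order_trans[OF abs_ge_self])
  also have "\<dots> \<le> norm (A u) * (L * norm u)"
    using bound[of ?v] v by (intro mult_left_mono) auto
  finally have "norm u * norm u \<le> (L * norm (A u)) * norm u"
    by (simp add: mult_ac)
  then show ?thesis
    using False by simp
qed

section \<open>A global inverse function theorem\<close>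

text \<open>Near \<open>p\<close> the map differs from its linearisation at \<open>p\<close> by a map whose Lipschitz constant is at most half
  the expansion factor of that linearisation. The radius on which this is true depends only on
  \<open>m\<close> and \<open>M\<close>, which is what makes the conclusion uniform.\<close>

lemma Lipschitz_derivative_imp_uniformly_locally_expanding:
  fixes f :: "'a::real_normed_vector \<Rightarrow> 'b::real_normed_vector"
  assumes f: "\<And>z. (f has_derivative D z) (at z)"
    and m: "m > 0" "\<And>z u. m * norm u \<le> norm (D z u)"
    and M: "M \<ge> 0" "\<And>z w u. norm (D z u - D w u) \<le> M * dist z w * norm u"
  obtains \<delta> where "\<delta> > 0" "\<And>p q. dist p q < \<delta> \<Longrightarrow> m / 2 * dist p q \<le> dist (f p) (f q)"
proof
  define \<delta> where "\<delta> = m / (2 * (M + 1))"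
  show "\<delta> > 0"
    using m M by (simp add: \<delta>_def)
  have M\<delta>: "M * \<delta> \<le> m / 2"
    using m M by (simp add: \<delta>_def field_simps)
  fix p q :: 'a assume pq: "dist p q < \<delta>"
  interpret Dp: bounded_linear "D p"
    using f by (rule has_derivative_bounded_linear)
  let ?h = "\<lambda>x. f x - D p x"
  have "norm (?h p - ?h q) \<le> m / 2 * norm (p - q)"
  proof (rule differentiable_bound[OF convex_ball[of p \<delta>]])
    show "(?h has_derivative (\<lambda>u. D x u - D p u)) (at x within ball p \<delta>)" for x
      using f[of x] by (intro has_derivative_diff Dp.has_derivative has_derivative_ident)
        (auto intro: has_derivative_at_withinI)
    show "onorm (\<lambda>u. D x u - D p u) \<le> m / 2" if "x \<in> ball p \<delta>" for x
    proof (rule onorm_bound)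
      show "0 \<le> m / 2"
        using m(1) by simp
      fix u
      have "norm (D x u - D p u) \<le> M * dist x p * norm u"
        by (rule M)
      also have "\<dots> \<le> M * \<delta> * norm u"
        using that M(1) by (intro mult_right_mono mult_left_mono) (auto simp: dist_commute)
      also have "\<dots> \<le> m / 2 * norm u"
        using M\<delta> by (rule mult_right_mono) simp
      finally show "norm (D x u - D p u) \<le> m / 2 * norm u" .
    qed
    show "p \<in> ball p \<delta>" "q \<in> ball p \<delta>"
      using pq \<open>\<delta> > 0\<close> by auto
  qed
  moreover have "D p (p - q) = (f p - f q) - (?h p - ?h q)"
    by (simp add: Dp.diff)
  then have "norm (D p (p - q)) \<le> norm (f p - f q) + norm (?h p - ?h q)"
    by (metis norm_triangle_ineq4)
  ultimately show "m / 2 * dist p q \<le> dist (f p) (f q)"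
    using m(2)[of "p - q" p] by (simp add: dist_norm)
qed

text \<open>Expansion makes \<open>f\<close> injective on the ball, so the image is open by invariance of domain, and it
  keeps the image of the bounding sphere at distance at least \<open>m * r\<close> from \<open>f z\<close>.\<close>

lemma locally_expanding_imp_ball_subset_image_ball:
  fixes f :: "'a::euclidean_space \<Rightarrow> 'a"
  assumes cont: "continuous_on UNIV f" and "m > 0"
    and exp: "\<And>p q. dist p q < \<delta> \<Longrightarrow> m * dist p q \<le> dist (f p) (f q)"
    and r: "0 < r" "2 * r < \<delta>"
  shows "ball (f z) (m * r) \<subseteq> f ` ball z r"
proof (rule ball_subset_open_map_image)
  show "continuous_on (closure (ball z r)) f"
    using cont continuous_on_subset by blast
  have "inj_on f (ball z r)"
  proof (rule inj_onI)
    fix p q assume pq: "p \<in> ball z r" "q \<in> ball z r" "f p = f q"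
    then have "dist p q < \<delta>"
      using dist_triangle_less_add[of p z r q r] r by (simp add: dist_commute)
    then have "m * dist p q \<le> 0"
      using exp[of p q] pq(3) by simp
    then show "p = q"
      using \<open>m > 0\<close> by (simp add: mult_le_0_iff)
  qed
  then show "open (f ` interior (ball z r))"
    using cont continuous_on_subset by (auto intro!: invariance_of_domain)
  show "m * r \<le> norm (f w - f z)" if "w \<in> frontier (ball z r)" for w
    using that exp[of w z] r by (simp add: dist_norm norm_minus_commute)
qed (use \<open>m > 0\<close> r in auto)

text \<open>The image contains, with each of its points, a ball of a fixed radius \<open>\<epsilon>\<close>, so it is everything.
  For the same reason every \<open>\<epsilon>\<close>-ball around \<open>w\<close> is evenly covered, with one sheet inside the ball of
  radius \<open>r\<close> around each preimage of \<open>w\<close>; two preimages of the same point are at distance at least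
  \<open>\<delta>\<close>, which keeps the sheets apart. Thus \<open>f\<close> is a covering map. Lifting the identity through it
  gives a section \<open>g\<close> through any chosen point, and uniqueness of lifts of \<open>f\<close> shows that \<open>g \<circ> f\<close> is
  the identity.\<close>

lemma uniformly_locally_expanding_imp_bij:
  fixes f :: "'a::euclidean_space \<Rightarrow> 'a"
  assumes cont: "continuous_on UNIV f" and "m > 0" "\<delta> > 0"
    and exp: "\<And>p q. dist p q < \<delta> \<Longrightarrow> m * dist p q \<le> dist (f p) (f q)"
  shows "bij f"
proof -
  \<comment> \<open>Any radius below \<open>\<delta> / 2\<close> works: points of one closed \<open>r\<close>-ball must be closer than \<open>\<delta>\<close>.\<close>
  define r where "r = \<delta> / 3"
  define \<epsilon> where "\<epsilon> = m * r"
  have r: "0 < r" "2 * r < \<delta>" and "\<epsilon> > 0"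
    using \<open>\<delta> > 0\<close> \<open>m > 0\<close> by (auto simp: r_def \<epsilon>_def)
  have img: "ball (f z) \<epsilon> \<subseteq> f ` ball z r" for z
    unfolding \<epsilon>_def by (rule locally_expanding_imp_ball_subset_image_ball[OF cont \<open>m > 0\<close> exp r])
  have eqI: "p = q" if "dist p q < \<delta>" "f p = f q" for p q
    using exp[OF that(1)] that(2) \<open>m > 0\<close> by (simp add: mult_le_0_iff)
  have near: "dist p q < \<delta>" if "p \<in> ball z r" "q \<in> ball z r" for p q z
    using dist_triangle_less_add[of p z r q r] r that by (simp add: dist_commute)
  have "open (range f)"
    unfolding open_contains_ball using img \<open>\<epsilon> > 0\<close> by blast
  moreover have "closed (range f)"
  proof -
    have "w \<in> range f" if w: "w \<in> closure (range f)" for w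
    proof -
      obtain z where "dist (f z) w < \<epsilon>"
        using w \<open>\<epsilon> > 0\<close> by (auto simp: closure_approachable)
      then show ?thesis
        using img[of z] by auto
    qed
    then show ?thesis
      using closure_subset_eq by blast
  qed
  ultimately have surj: "range f = UNIV"
    using clopen by blast
  have cov: "covering_space UNIV f UNIV"
  proof (rule covering_spaceI[OF cont surj])
    fix w :: 'a
    let ?T = "ball w \<epsilon>"
    define V where "V z = ball z r \<inter> f -` ?T" for z
    have openV: "open (V z)" for z
      unfolding V_def using cont by (intro open_Int open_ball continuous_open_vimage)
        (auto simp: continuous_on_eq_continuous_at)
    show "\<exists>T. w \<in> T \<and> openin (top_of_set UNIV) T \<and>
        (\<exists>v. \<Union>v = UNIV \<inter> f -` T \<and> (\<forall>u\<in>v. openin (top_of_set UNIV) u) \<and>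
          pairwise disjnt v \<and> (\<forall>u\<in>v. \<exists>q. homeomorphism u T f q))"
    proof (intro exI[of _ ?T] conjI exI[of _ "V ` (f -` {w})"] ballI)
      show "w \<in> ?T"
        using \<open>\<epsilon> > 0\<close> by simp
      show "openin (top_of_set UNIV) ?T"
        by simp
      \<comment> \<open>As \<open>w\<close> lies in the \<open>\<epsilon>\<close>-ball around \<open>f p\<close>, it has a preimage close to \<open>p\<close>.\<close>
      have "p \<in> \<Union>(V ` (f -` {w}))" if p: "f p \<in> ?T" for p
      proof -
        have "w \<in> f ` ball p r"
          using img[of p] p by (auto simp: dist_commute)
        then obtain z where "z \<in> ball p r" "f z = w"
          by auto
        then show ?thesis
          using p by (auto simp: V_def dist_commute)
      qed
      then show "\<Union>(V ` (f -` {w})) = UNIV \<inter> f -` ?T"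
        by (auto simp: V_def)
      have "z = z'" if "f z = w" "f z' = w" "p \<in> V z" "p \<in> V z'" for z z' p
      proof (rule eqI)
        have "z \<in> ball p r" "z' \<in> ball p r"
          using that by (auto simp: V_def dist_commute)
        then show "dist z z' < \<delta>"
          by (rule near)
      qed (use that in simp)
      then show "pairwise disjnt (V ` (f -` {w}))"
        by (auto simp: pairwise_def disjnt_iff) 
    next
      fix u assume "u \<in> V ` (f -` {w})"
      then obtain z where z: "f z = w" and u: "u = V z"
        by auto
      show "openin (top_of_set UNIV) u"
        using openV u by simp
      have "f ` u = ?T"
        using img[of z] z by (auto simp: u V_def)
      moreover have "inj_on f u"
        by (rule inj_onI) (auto simp: u V_def intro!: eqI near[of _ z])
      ultimately show "\<exists>q. homeomorphism u ?T f q"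
        using invariance_of_domain_homeomorphism[of u f] openV u cont continuous_on_subset
        by (metis order_refl subset_UNIV)
    qed
  qed
  have "inj f"
  proof (rule injI)
    fix a b assume ab: "f a = f b"
    obtain g where g: "continuous_on UNIV g" "g (f a) = a" "\<And>y. f (g y) = y"
      using covering_space_lift_strong[OF cov UNIV_I UNIV_I, where f = "\<lambda>x. x"
          and z = "f a" and a = a]
      by (auto simp: convex_imp_simply_connected convex_imp_locally_path_connected)
    have gf: "continuous_on UNIV (g \<circ> f)"
      using cont g(1) continuous_on_subset by (blast intro: continuous_on_compose)
    have "(g \<circ> f) b = id b"
      by (rule covering_space_lift_unique[OF cov, of "g \<circ> f" a id UNIV f])
        (simp_all add: gf[unfolded o_def] g(2,3) cont connected_UNIV)
    then show "a = b"
      using ab g(2) by (metis comp_apply id_apply)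
  qed
  with surj show ?thesis
    by (simp add: bij_def)
qed

text \<open>The segment from \<open>x\<close> to \<open>y\<close> is cut into steps shorter than \<open>\<epsilon>\<close>.\<close>

lemma uniformly_locally_Lipschitz_imp_Lipschitz:
  fixes g :: "'a::real_normed_vector \<Rightarrow> 'b::metric_space"
  assumes "\<epsilon> > 0" and loc: "\<And>x y. dist x y < \<epsilon> \<Longrightarrow> dist (g x) (g y) \<le> K * dist x y"
  shows "dist (g x) (g y) \<le> K * dist x y"
proof -
  obtain N :: nat where N: "dist x y / \<epsilon> < real N"
    using reals_Archimedean2 by blast
  moreover have "0 \<le> dist x y / \<epsilon>"
    using \<open>\<epsilon> > 0\<close> by simp
  ultimately have "N > 0"
    by linarith
  define w where "w i = x + (real i / real N) *\<^sub>R (y - x)" for i :: nat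
  have step: "dist (w i) (w (Suc i)) = dist x y / real N" for i
  proof -
    have "w (Suc i) - w i = (1 / real N) *\<^sub>R (y - x)"
      by (simp add: w_def add_divide_distrib flip: scaleR_diff_left)
    then show ?thesis
      by (simp add: dist_norm norm_minus_commute[of "w i"] norm_minus_commute[of x])
  qed
  have "dist x y / real N < \<epsilon>"
    using N \<open>N > 0\<close> \<open>\<epsilon> > 0\<close> by (simp add: field_simps)
  define s where "s = K * (dist x y / real N)"
  have gstep: "dist (g (w i)) (g (w (Suc i))) \<le> s" for i
    using loc[of "w i" "w (Suc i)"] \<open>dist x y / real N < \<epsilon>\<close> by (simp add: step s_def)
  have "dist (g (w 0)) (g (w n)) \<le> real n * s" for n
  proof (induction n)
    case (Suc n)
    then show ?case
      using dist_triangle[of "g (w 0)" "g (w (Suc n))" "g (w n)"] gstep[of n]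
      by (simp add: distrib_right)
  qed simp
  from this[of N] show ?thesis
    using \<open>N > 0\<close> by (simp add: w_def s_def)
qed

text \<open>Expansion of \<open>f\<close> bounds \<open>inv f\<close> at points whose preimages are close. That nearby points do have
  nearby preimages follows because \<open>f\<close> maps a small ball onto a set containing a ball of fixed radius,
  and the preimage found there is the only one.\<close>

lemma uniformly_locally_expanding_imp_inv_Lipschitz:
  fixes f :: "'a::euclidean_space \<Rightarrow> 'a"
  assumes cont: "continuous_on UNIV f" and "m > 0" "\<delta> > 0"
    and exp: "\<And>p q. dist p q < \<delta> \<Longrightarrow> m * dist p q \<le> dist (f p) (f q)"
  shows "dist (inv f x) (inv f y) \<le> 1 / m * dist x y"
proof (rule uniformly_locally_Lipschitz_imp_Lipschitz)
  have "bij f"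
    using assms by (rule uniformly_locally_expanding_imp_bij)
  then have inv: "f (inv f w) = w" "inv f (f z) = z" for w z
    by (simp_all add: bij_is_surj surj_f_inv_f bij_is_inj inv_f_f)
  show "m * (\<delta> / 3) > 0"
    using \<open>m > 0\<close> \<open>\<delta> > 0\<close> by simp
  fix v w :: 'a assume "dist v w < m * (\<delta> / 3)"
  moreover have "ball (f (inv f v)) (m * (\<delta> / 3)) \<subseteq> f ` ball (inv f v) (\<delta> / 3)"
    by (rule locally_expanding_imp_ball_subset_image_ball[OF cont \<open>m > 0\<close> exp]) (use \<open>\<delta> > 0\<close> in auto)
  ultimately obtain z where z: "z \<in> ball (inv f v) (\<delta> / 3)" "w = f z"
    by (auto simp: inv)
  then have "dist (inv f v) (inv f w) < \<delta>"
    using \<open>\<delta> > 0\<close> by (simp add: inv)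
  from exp[OF this] show "dist (inv f v) (inv f w) \<le> 1 / m * dist v w"
    using \<open>m > 0\<close> by (simp add: inv field_simps)
qed

section \<open>Tame canonical transformations are bi-Lipschitz\<close>

lemma uniform_bound_of_finite_family:
  assumes "finite I" and "\<And>i. i \<in> I \<Longrightarrow> \<exists>C. \<forall>z. norm (F i z) \<le> C"
  shows "\<exists>C\<ge>0. \<forall>i\<in>I. \<forall>z. norm (F i z) \<le> C"
proof -
  obtain c where c: "\<And>i z. i \<in> I \<Longrightarrow> norm (F i z) \<le> c i"
    using assms(2) by metis
  show ?thesis
  proof (intro exI conjI ballI allI)
    show "(\<Sum>i\<in>I. \<bar>c i\<bar>) \<ge> 0"
      by (simp add: sum_nonneg)
    show "norm (F i z) \<le> (\<Sum>i\<in>I. \<bar>c i\<bar>)" if "i \<in> I" for i z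
      using c[OF that, of z] member_le_sum[OF that, of "\<lambda>i. \<bar>c i\<bar>"] \<open>finite I\<close> by fastforce
  qed
qed

lemma tame_canonical_transformation_bi_Lipschitz:
  fixes \<kappa> :: "'d::finite phase \<Rightarrow> 'd phase"
  assumes tame: "tame_canonical_transformation \<kappa>"
  obtains L where "L > 0" "bij \<kappa>"
    "\<And>z w. dist (\<kappa> z) (\<kappa> w) \<le> L * dist z w"
    "\<And>z w. dist (inv \<kappa> z) (inv \<kappa> w) \<le> L * dist z w"
proof -
  let ?B = "Basis :: 'd phase set"
  let ?D = "\<lambda>z. frechet_derivative \<kappa> (at z)"
  have diff: "iterated_partial bs \<kappa> differentiable at z" if "set bs \<subseteq> ?B" for bs z
    using tame that
    by (simp add: tame_canonical_transformation_def smooth_map_def del: split_paired_All)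
  have bdd: "\<exists>C. \<forall>z. norm (iterated_partial bs \<kappa> z) \<le> C" if "set bs \<subseteq> ?B" "bs \<noteq> []" for bs
    using tame that
    by (simp add: tame_canonical_transformation_def Suc_le_eq del: split_paired_All)
  have diff0: "\<kappa> differentiable at z" for z
    using diff[of "[]"] by simp
  have diff1: "partial_deriv b \<kappa> differentiable at z" if "b \<in> ?B" for b z
    using diff[of "[b]"] that by simp
  have bdd1: "\<exists>C. \<forall>z. norm (partial_deriv b \<kappa> z) \<le> C" if "b \<in> ?B" for b
    using bdd[of "[b]"] that by (simp del: split_paired_All)
  have bdd2: "\<exists>C. \<forall>z. norm (partial_deriv (snd bc) (partial_deriv (fst bc) \<kappa>) z) \<le> C"
    if "bc \<in> ?B \<times> ?B" for bc
    using bdd[of "[snd bc, fst bc]"] that by (simp add: mem_Times_iff del: split_paired_All)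
  have "\<exists>C\<ge>0. \<forall>b\<in>?B. \<forall>z. norm (partial_deriv b \<kappa> z) \<le> C"
    by (rule uniform_bound_of_finite_family[OF finite_Basis]) (rule bdd1)
  then obtain C1 where "C1 \<ge> 0" and C1: "\<And>b z. b \<in> ?B \<Longrightarrow> norm (partial_deriv b \<kappa> z) \<le> C1"
    by metis
  have "\<exists>C\<ge>0. \<forall>bc\<in>?B \<times> ?B. \<forall>z. norm (partial_deriv (snd bc) (partial_deriv (fst bc) \<kappa>) z) \<le> C"
    by (rule uniform_bound_of_finite_family[OF finite_cartesian_product[OF finite_Basis finite_Basis]])
      (rule bdd2)
  then obtain C2 where "C2 \<ge> 0" and C2: "\<And>bc z. bc \<in> ?B \<times> ?B \<Longrightarrow>
      norm (partial_deriv (snd bc) (partial_deriv (fst bc) \<kappa>) z) \<le> C2"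
    by metis
  \<comment> \<open>The summand 1 keeps \<open>L\<close> positive even if \<open>C1\<close> is 0.\<close>
  define L where "L = real DIM('d phase) * C1 + 1"
  define M where "M = real DIM('d phase) * (real DIM('d phase) * C2)"
  have "L > 0" "M \<ge> 0"
    using \<open>C1 \<ge> 0\<close> \<open>C2 \<ge> 0\<close> by (auto simp: L_def M_def intro!: add_nonneg_pos)
  have DL: "norm (?D z u) \<le> L * norm u" for z u
    using norm_frechet_derivative_le_of_bounded_partials[OF diff0 C1, of z u]
    by (simp add: L_def distrib_right add_increasing2)
  have lip: "dist (\<kappa> z) (\<kappa> w) \<le> L * dist z w" for z w
    using bounded_partials_imp_Lipschitz[OF diff0 C1, of z w]
    by (simp add: L_def distrib_right add_increasing2)
  have "symplectic_form (?D z u) (?D z v) = symplectic_form u v" for z u v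
    using tame unfolding tame_canonical_transformation_def canonical_def by blast
  then have "norm u \<le> L * norm (?D z u)" for z u
    using DL by (rule symplectic_preserving_imp_expanding)
  then have exp: "1 / L * norm u \<le> norm (?D z u)" for z u
    using \<open>L > 0\<close> by (simp add: field_simps)
  have D: "(\<kappa> has_derivative ?D z) (at z)" for z
    using diff0 frechet_derivative_works by blast
  have LipD: "norm (?D z u - ?D w u) \<le> M * dist z w * norm u" for z w u
    unfolding M_def
  proof (rule bounded_second_partials_imp_Lipschitz_derivative[OF diff0 diff1])
    show "norm (partial_deriv c (partial_deriv b \<kappa>) z) \<le> C2" if "b \<in> ?B" "c \<in> ?B" for b c z
      using C2[of "(b, c)"] that by simp
  qed
  obtain \<delta> where \<delta>: "\<delta> > 0"
    "\<And>p q. dist p q < \<delta> \<Longrightarrow> 1 / L / 2 * dist p q \<le> dist (\<kappa> p) (\<kappa> q)"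
    using Lipschitz_derivative_imp_uniformly_locally_expanding[OF D _ exp \<open>M \<ge> 0\<close> LipD] \<open>L > 0\<close>
    by (metis zero_less_divide_1_iff)
  have cont: "continuous_on UNIV \<kappa>"
    using diff0 by (simp add: continuous_at_imp_continuous_on differentiable_imp_continuous_within)
  show ?thesis
  proof
    show "2 * L > 0"
      using \<open>L > 0\<close> by simp
    show "bij \<kappa>"
      by (rule uniformly_locally_expanding_imp_bij[OF cont _ \<delta>]) (use \<open>L > 0\<close> in auto)
    show "dist (\<kappa> z) (\<kappa> w) \<le> 2 * L * dist z w" for z w
      using lip[of z w] \<open>L > 0\<close> by (smt (verit) mult_right_mono zero_le_dist)
    show "dist (inv \<kappa> z) (inv \<kappa> w) \<le> 2 * L * dist z w" for z w
      using uniformly_locally_expanding_imp_inv_Lipschitz[OF cont _ \<delta>, of z w] \<open>L > 0\<close>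
      by (simp add: mult_ac)
  qed
qed

section \<open>Vertical nonrefocusing as an inequality\<close>

lemma conic_neighborhood_contains_cone:
  fixes \<Gamma> :: "('d::finite) phase set"
  assumes "open \<Gamma>" "conic_set \<Gamma>" and vert: "{0} \<times> (UNIV - {0}) \<subseteq> \<Gamma>"
  obtains c where "c > 0" "\<And>x \<xi>. norm x < c * norm \<xi> \<Longrightarrow> (x, \<xi>) \<in> \<Gamma>"
proof -
  let ?S = "{0 :: real ^ 'd} \<times> sphere (0 :: real ^ 'd) 1"
  have compact: "compact ?S"
    by (intro compact_Times) auto
  have "?S \<subseteq> \<Gamma>"
    using vert by auto
  then obtain c where "c > 0" and c: "(\<Union>z\<in>?S. ball z c) \<subseteq> \<Gamma>"
    by (rule compact_subset_open_imp_ball_epsilon_subset[OF compact \<open>open \<Gamma>\<close>])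
  have "(x, \<xi>) \<in> \<Gamma>" if less: "norm x < c * norm \<xi>" for x \<xi>
  proof -
    let ?n = "norm \<xi>"
    have n: "?n > 0"
      using less by (metis mult_zero_right norm_ge_zero not_less zero_less_norm_iff norm_zero)
    have "dist (0, \<xi> /\<^sub>R ?n) (x /\<^sub>R ?n, \<xi> /\<^sub>R ?n) = norm x / ?n"
      by (simp add: dist_prod_def divide_inverse mult.commute)
    also have "\<dots> < c"
      using less n by (simp add: field_simps)
    finally have "dist (0, \<xi> /\<^sub>R ?n) (x /\<^sub>R ?n, \<xi> /\<^sub>R ?n) < c" .
    moreover have "(0, \<xi> /\<^sub>R ?n) \<in> ?S"
      using n by simp
    ultimately have "(x /\<^sub>R ?n, \<xi> /\<^sub>R ?n) \<in> \<Gamma>"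
      using c by (meson UN_I mem_ball subsetD)
    then have "?n *\<^sub>R (x /\<^sub>R ?n, \<xi> /\<^sub>R ?n) \<in> \<Gamma>"
      using \<open>conic_set \<Gamma>\<close> n unfolding conic_set_def by blast
    then show ?thesis
      using n by simp
  qed
  with \<open>c > 0\<close> that show ?thesis
    by blast
qed

lemma vertical_nonrefocusing_iff:
  fixes \<kappa> :: "'d::finite phase \<Rightarrow> 'd phase"
  shows "vertical_nonrefocusing \<kappa> \<longleftrightarrow>
    (\<exists>c>0. \<exists>R>0. \<forall>\<eta>. norm \<eta> > R \<longrightarrow> c * norm (snd (\<kappa> (0, \<eta>))) \<le> norm (fst (\<kappa> (0, \<eta>))))"
  (is "_ \<longleftrightarrow> ?rhs")
proof
  assume "vertical_nonrefocusing \<kappa>"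
  then obtain \<Gamma> R where \<Gamma>: "open \<Gamma>" "conic_set \<Gamma>" "{0} \<times> (UNIV - {0}) \<subseteq> \<Gamma>"
    and R: "R > 0" "\<forall>\<eta>. norm \<eta> > R \<longrightarrow> \<kappa> (0, \<eta>) \<notin> \<Gamma>"
    unfolding vertical_nonrefocusing_def by blast
  obtain c where "c > 0" "\<And>x \<xi>. norm x < c * norm \<xi> \<Longrightarrow> (x, \<xi>) \<in> \<Gamma>"
    using conic_neighborhood_contains_cone[OF \<Gamma>] by blast
  with R show ?rhs
    by (metis linorder_not_less prod.collapse)
next
  assume ?rhs
  then obtain c R where "c > 0" "R > 0"
    and cR: "\<And>\<eta>. norm \<eta> > R \<Longrightarrow> c * norm (snd (\<kappa> (0, \<eta>))) \<le> norm (fst (\<kappa> (0, \<eta>)))"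
    by blast
  let ?\<Gamma> = "{z :: 'd phase. norm (fst z) < c * norm (snd z)}"
  have "open ?\<Gamma>"
    by (intro open_Collect_less continuous_intros)
  moreover have "conic_set ?\<Gamma>"
    by (simp add: conic_set_def)
  moreover have "?\<Gamma> \<subseteq> UNIV - {0}"
    by auto
  moreover have "{0} \<times> (UNIV - {0}) \<subseteq> ?\<Gamma>"
    using \<open>c > 0\<close> by (auto simp: zero_less_mult_iff)
  moreover have "\<forall>\<eta>. norm \<eta> > R \<longrightarrow> \<kappa> (0, \<eta>) \<notin> ?\<Gamma>"
    using cR by (simp add: not_less)
  ultimately show "vertical_nonrefocusing \<kappa>"
    unfolding vertical_nonrefocusing_def using \<open>R > 0\<close> by blast
qed

section \<open>Passing to the inverse\<close>

text \<open>A point \<open>g (0, \<zeta>) = (y, \<eta>)\<close> with \<open>\<bar>y\<bar> \<le> e \<bar>\<eta>\<bar>\<close> is compared with \<open>(0, \<eta>)\<close>. The Lipschitz bound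
  for \<open>f\<close> gives \<open>\<bar>x\<bar> \<le> L e \<bar>\<eta>\<bar>\<close> for \<open>(x, \<xi>) = f (0, \<eta>)\<close>, nonrefocusing of \<open>f\<close> bounds \<open>\<xi>\<close> by \<open>x\<close>, and
  the Lipschitz bound for \<open>g\<close> then bounds \<open>\<eta>\<close> by \<open>(x, \<xi>)\<close>. Altogether
  \<open>\<bar>\<eta>\<bar> \<le> \<bar>g 0\<bar> + K e \<bar>\<eta>\<bar>\<close>, and \<open>e\<close> is chosen so that \<open>K e \<le> 1 / 2\<close>: then \<open>\<eta>\<close> is bounded, which is
  impossible for large \<open>\<zeta>\<close>.\<close>

lemma vertical_nonrefocusing_inverse:
  fixes f g :: "'d::finite phase \<Rightarrow> 'd phase"
  assumes "L > 0"
    and lipf: "\<And>z w. dist (f z) (f w) \<le> L * dist z w"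
    and lipg: "\<And>z w. dist (g z) (g w) \<le> L * dist z w"
    and fg: "\<And>z. f (g z) = z" and gf: "\<And>z. g (f z) = z"
    and "vertical_nonrefocusing f"
  shows "vertical_nonrefocusing g"
proof -
  obtain c R where "c > 0" "R > 0"
    and cR: "\<And>\<eta>. norm \<eta> > R \<Longrightarrow> c * norm (snd (f (0, \<eta>))) \<le> norm (fst (f (0, \<eta>)))"
    using \<open>vertical_nonrefocusing f\<close> unfolding vertical_nonrefocusing_iff by blast
  define K where "K = L * (1 + 1 / c) * L"
  define e where "e = min 1 (1 / (2 * K))"
  have "K > 0"
    using \<open>c > 0\<close> \<open>L > 0\<close> by (simp add: K_def add_pos_pos)
  then have e: "e > 0" "e \<le> 1" "K * e \<le> 1 / 2"
    by (auto simp: e_def min_def field_simps)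
  \<comment> \<open>Since \<open>\<bar>\<zeta>\<bar> \<le> \<bar>f 0\<bar> + 2 L \<bar>\<eta>\<bar>\<close>, this threshold forces \<open>\<bar>\<eta>\<bar> > R + 2 \<bar>g 0\<bar>\<close>.\<close>
  define R' where "R' = norm (f 0) + 2 * L * (R + 2 * norm (g 0)) + 1"
  have "R' > 0"
    using \<open>L > 0\<close> \<open>R > 0\<close> by (simp add: R'_def add_nonneg_pos)
  have "e * norm (snd (g (0, \<zeta>))) \<le> norm (fst (g (0, \<zeta>)))" if \<zeta>: "norm \<zeta> > R'" for \<zeta> :: "real ^ 'd"
  proof (rule ccontr)
    obtain y \<eta> where y\<eta>: "g (0, \<zeta>) = (y, \<eta>)"
      by (cases "g (0, \<zeta>)")
    assume "\<not> ?thesis"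
    then have y: "norm y \<le> e * norm \<eta>"
      by (simp add: y\<eta>)
    obtain x \<xi> where x\<xi>: "f (0, \<eta>) = (x, \<xi>)"
      by (cases "f (0, \<eta>)")
    have f: "f (y, \<eta>) = (0, \<zeta>)"
      using fg[of "(0, \<zeta>)"] by (simp add: y\<eta>)
    have "norm \<zeta> \<le> norm (f 0) + dist (f (y, \<eta>)) (f 0)"
      using norm_triangle_sub[of "f (y, \<eta>)" "f 0"] by (simp add: f dist_norm norm_Pair)
    also have "dist (f (y, \<eta>)) (f 0) \<le> L * norm (y, \<eta>)"
      using lipf[of "(y, \<eta>)" 0] by simp
    also have "norm (y, \<eta>) \<le> norm y + norm \<eta>"
      by (rule norm_Pair_le)
    also have "norm y \<le> norm \<eta>"
      using y mult_right_mono[OF e(2), of "norm \<eta>"] by simp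
    finally have "norm \<zeta> \<le> norm (f 0) + 2 * L * norm \<eta>"
      using \<open>L > 0\<close> by (simp add: algebra_simps)
    with \<zeta> have "2 * L * (R + 2 * norm (g 0)) < 2 * L * norm \<eta>"
      by (simp add: R'_def)
    then have big: "R + 2 * norm (g 0) < norm \<eta>"
      using \<open>L > 0\<close> by simp
    have "norm x \<le> dist (f (0, \<eta>)) (f (y, \<eta>))"
      using norm_fst_le[of x "\<xi> - \<zeta>"] by (simp add: f x\<xi> dist_norm)
    also have "\<dots> \<le> L * norm y"
      using lipf[of "(0, \<eta>)" "(y, \<eta>)"] by (simp add: dist_prod_def)
    also have "\<dots> \<le> L * (e * norm \<eta>)"
      using y \<open>L > 0\<close> by simp
    finally have x: "norm x \<le> L * (e * norm \<eta>)" .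
    have "c * norm \<xi> \<le> norm x"
      using cR[of \<eta>] big norm_ge_zero[of "g 0"] by (simp add: x\<xi>)
    then have \<xi>: "norm \<xi> \<le> 1 / c * norm x"
      using \<open>c > 0\<close> by (simp add: field_simps)
    have "norm \<eta> \<le> norm (g 0) + dist (g (x, \<xi>)) (g 0)"
      using norm_triangle_sub[of "g (x, \<xi>)" "g 0"] gf[of "(0, \<eta>)"] by (simp add: x\<xi> dist_norm norm_Pair)
    also have "dist (g (x, \<xi>)) (g 0) \<le> L * norm (x, \<xi>)"
      using lipg[of "(x, \<xi>)" 0] by simp
    also have "norm (x, \<xi>) \<le> norm x + norm \<xi>"
      by (rule norm_Pair_le)
    also have "\<dots> \<le> (1 + 1 / c) * norm x"
      using \<xi> by (simp add: algebra_simps)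
    also have "\<dots> \<le> (1 + 1 / c) * (L * (e * norm \<eta>))"
      using x \<open>c > 0\<close> by (intro mult_left_mono) auto
    finally have "norm \<eta> \<le> norm (g 0) + (K * e) * norm \<eta>"
      using \<open>L > 0\<close> by (simp add: K_def mult_ac)
    also have "\<dots> \<le> norm (g 0) + 1 / 2 * norm \<eta>"
      using e(3) by (intro add_left_mono mult_right_mono) auto
    finally show False
      using big \<open>R > 0\<close> by simp
  qed
  then show ?thesis
    unfolding vertical_nonrefocusing_iff using e(1) \<open>R' > 0\<close> by blast
qed

theorem proposition3p2:
  fixes \<kappa> :: "'d::finite phase \<Rightarrow> 'd phase"
  assumes "tame_canonical_transformation \<kappa>"
  shows "vertical_nonrefocusing \<kappa> \<longleftrightarrow> vertical_nonrefocusing (inv \<kappa>)"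
proof -
  obtain L where L: "L > 0" and bij: "bij \<kappa>"
    and lip: "\<And>z w. dist (\<kappa> z) (\<kappa> w) \<le> L * dist z w"
    and lip_inv: "\<And>z w. dist (inv \<kappa> z) (inv \<kappa> w) \<le> L * dist z w"
    using tame_canonical_transformation_bi_Lipschitz[OF assms] by blast
  have inv: "\<kappa> (inv \<kappa> z) = z" "inv \<kappa> (\<kappa> z) = z" for z
    using bij by (simp_all add: bij_is_surj surj_f_inv_f bij_is_inj inv_f_f)
  show ?thesis
    using vertical_nonrefocusing_inverse[OF L lip lip_inv inv]
      vertical_nonrefocusing_inverse[OF L lip_inv lip inv(2) inv(1)]
    by blast
qed

end
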